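(* Let $n\geq 1$ be an integer and let $X_1,\dots,X_n$ be $n$ independent identically distributed symmetric real-valued random variables. For any real numbers $x,y>0$, we have $$\mathbb{P}\big(X_1+\dots+X_n\geq x,\; X_1^2+\dots+X_n^2\leq y\big)<\exp\left(-\frac{x^2}{2y}\right).$$
   Context: The random variables are defined on a common probability space with probability measure $\mathbb{P}$. A real-valued random variable $X$ is called symmetric if $X$ and $-X$ have the same distribution. No integrability condition on the variables is assumed. The comma inside the probability denotes the intersection of the two events. *)

theory Defs
  imports "HOL-Probability.Probability"
begin

definition symmetric_rv :: "'a measure \<Rightarrow> ('a \<Rightarrow> real) \<Rightarrow> bool" where
  "symmetric_rv M X \<longleftrightarrow>
     X \<in> borel_measurable M \<and> distr M borel X = distr M borel (\<lambda>\<omega>. - X \<omega>)"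

definition identically_distributed :: "'a measure \<Rightarrow> ('i \<Rightarrow> 'a \<Rightarrow> real) \<Rightarrow> 'i set \<Rightarrow> bool" where
  "identically_distributed M X I \<longleftrightarrow>
     (\<forall>i\<in>I. X i \<in> borel_measurable M) \<and>
     (\<forall>i\<in>I. \<forall>j\<in>I. distr M borel (X i) = distr M borel (X j))"

end

theory Submission
  imports Defs
begin

text \<open>
  The constraint on the sum of squares lets one use the self-normalised weight
  \<open>exp (t S - t\<^sup>2 V / 2)\<close>, with \<open>S\<close> the sum and \<open>V\<close> the sum of squares, in place of \<open>exp (t S)\<close>.
  It is a product of bounded independent factors, each of mean at most \<open>1\<close>: symmetrising a factor
  replaces \<open>exp (t X)\<close> by \<open>cosh (t X) \<le> exp (t\<^sup>2 X\<^sup>2 / 2)\<close>. For \<open>t = x / y\<close> the weight is at least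
  \<open>exp (x\<^sup>2 / (2 y))\<close> on the event, so Markov's inequality gives the bound. Equality in Markov's
  inequality would force the positive weight to vanish almost surely off the event, so the event
  would have probability \<open>1\<close>, whereas the bound is below \<open>1\<close>.
\<close>

text \<open>Both sides are even, so \<open>u \<ge> 0\<close> suffices. There the ratio
  \<open>cosh u * exp (- (u\<^sup>2 / 2))\<close> equals 1 at 0 and is nonincreasing, its derivative
  having the sign of \<open>sinh u - u * cosh u\<close>.\<close>

lemma cosh_le_exp_half_square: "cosh (u::real) \<le> exp (u\<^sup>2 / 2)"
proof -
  have nonneg: "cosh u \<le> exp (u\<^sup>2 / 2)" if "u \<ge> 0" for u :: real
  proof -
    \<comment> \<open>The difference \<open>v * cosh v - sinh v\<close> vanishes at 0 and has
      derivative \<open>v * sinh v \<ge> 0\<close>.\<close>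
    have sinh_le: "sinh v \<le> v * cosh v" if "v \<ge> 0" for v :: real
    proof -
      have "0 * cosh 0 - sinh 0 \<le> v * cosh v - sinh v"
        by (rule DERIV_nonneg_imp_nondecreasing[OF that])
           (auto intro!: exI derivative_eq_intros)
      then show ?thesis by simp
    qed
    have "cosh u * exp (- (u\<^sup>2 / 2)) \<le> cosh 0 * exp (- (0\<^sup>2 / 2))"
    proof (rule DERIV_nonpos_imp_nonincreasing[OF that])
      fix v :: real assume "0 \<le> v"
      then have "(sinh v - v * cosh v) * exp (- (v\<^sup>2 / 2)) \<le> 0"
        using sinh_le by (simp add: mult_nonpos_nonneg)
      moreover have "((\<lambda>v. cosh v * exp (- (v\<^sup>2 / 2))) has_real_derivative
          (sinh v - v * cosh v) * exp (- (v\<^sup>2 / 2))) (at v)"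
        by (auto intro!: derivative_eq_intros simp: algebra_simps)
      ultimately show "\<exists>d. ((\<lambda>v. cosh v * exp (- (v\<^sup>2 / 2))) has_real_derivative d) (at v) \<and> d \<le> 0"
        by blast
    qed
    then show ?thesis by (simp add: exp_minus field_simps)
  qed
  show ?thesis using nonneg[of u] nonneg[of "- u"] by (cases "u \<ge> 0") auto
qed

text \<open>Completing the square bounds the exponent by 1/2, so no moment of \<open>X\<close> has
  to exist.\<close>

lemma (in prob_space) integrable_self_normalised_exp:
  fixes X :: "'a \<Rightarrow> real"
  assumes [measurable]: "random_variable borel X"
  shows "integrable M (\<lambda>\<omega>. exp (t * X \<omega> - (t * X \<omega>)\<^sup>2 / 2))"
proof (rule integrable_const_bound)
  have "u - u\<^sup>2 / 2 \<le> 1 / 2" for u :: real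
    using zero_le_power2[of "u - 1"] by (simp add: power2_diff)
  then show "AE \<omega> in M. norm (exp (t * X \<omega> - (t * X \<omega>)\<^sup>2 / 2)) \<le> exp (1 / 2)"
    by simp
qed measurable

lemma (in prob_space) expectation_self_normalised_exp_le_1:
  assumes "symmetric_rv M X"
  shows "expectation (\<lambda>\<omega>. exp (t * X \<omega> - (t * X \<omega>)\<^sup>2 / 2)) \<le> 1"
proof -
  define f where "f v = exp (t * v - (t * v)\<^sup>2 / 2)" for v :: real
  have X [measurable]: "random_variable borel X"
    and eq: "distr M borel X = distr M borel (\<lambda>\<omega>. - X \<omega>)"
    using assms by (auto simp: symmetric_rv_def)
  have f [measurable]: "f \<in> borel_measurable borel"
    unfolding f_def by measurable
  \<comment> \<open>Since the square is even, \<open>f (- X \<omega>)\<close> is the same weight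
    with \<open>- t\<close> in place of \<open>t\<close>.\<close>
  have int: "integrable M (\<lambda>\<omega>. f (X \<omega>))" "integrable M (\<lambda>\<omega>. f (- X \<omega>))"
    using integrable_self_normalised_exp[OF X, of t]
      integrable_self_normalised_exp[OF X, of "- t"]
    by (simp_all add: f_def)
  have "expectation (\<lambda>\<omega>. f (X \<omega>)) = integral\<^sup>L (distr M borel X) f"
    by (subst integral_distr) auto
  also have "\<dots> = expectation (\<lambda>\<omega>. f (- X \<omega>))"
    unfolding eq by (subst integral_distr) auto
  finally have "expectation (\<lambda>\<omega>. f (X \<omega>)) = expectation (\<lambda>\<omega>. (f (X \<omega>) + f (- X \<omega>)) / 2)"
    using int by simp
  also have "\<dots> \<le> expectation (\<lambda>\<omega>. 1)"
  proof (rule integral_mono)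
    fix \<omega>
    have "(f (X \<omega>) + f (- X \<omega>)) / 2 = cosh (t * X \<omega>) / exp ((t * X \<omega>)\<^sup>2 / 2)"
      by (simp add: f_def exp_diff cosh_field_def add_divide_distrib)
    also have "\<dots> \<le> 1"
      using cosh_le_exp_half_square[of "t * X \<omega>"] by simp
    finally show "(f (X \<omega>) + f (- X \<omega>)) / 2 \<le> 1" .
  qed (use int in auto)
  finally show ?thesis
    by (simp add: f_def prob_space)
qed

lemma (in prob_space) prob_less_of_positive_weight:
  fixes Z :: "'a \<Rightarrow> real"
  assumes A [measurable]: "A \<in> events"
    and Z: "integrable M Z" "\<And>\<omega>. \<omega> \<in> space M \<Longrightarrow> 0 < Z \<omega>" "expectation Z \<le> 1"
    and ge: "\<And>\<omega>. \<omega> \<in> A \<Longrightarrow> c \<le> Z \<omega>"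
    and "c > 1"
  shows "prob A < 1 / c"
proof (rule ccontr)
  assume "\<not> ?thesis"
  with \<open>c > 1\<close> have "1 \<le> c * prob A"
    by (simp add: field_simps)
  \<comment> \<open>\<open>D\<close> is the pointwise slack in Markov's inequality. It is
    nonnegative, while the negated claim makes its mean at most 0, so it vanishes almost surely; off
    \<open>A\<close> it equals \<open>Z > 0\<close>, hence \<open>A\<close> has full
    measure.\<close>
  define D where "D \<omega> = Z \<omega> - c * indicator A \<omega>" for \<omega>
  have int: "integrable M D"
    unfolding D_def using Z(1) by (auto simp: emeasure_eq_measure)
  have nonneg: "0 \<le> D \<omega>" if "\<omega> \<in> space M" for \<omega>
    using Z(2)[OF that] ge[of \<omega>] by (auto simp: D_def indicator_def)
  have "expectation D = expectation Z - c * prob A"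
    unfolding D_def using Z(1) by (subst Bochner_Integration.integral_diff) (auto simp: emeasure_eq_measure)
  with Z(3) \<open>1 \<le> c * prob A\<close> have "expectation D \<le> 0"
    by simp
  moreover have "expectation D \<ge> 0"
    by (rule Bochner_Integration.integral_nonneg) (use nonneg in auto)
  ultimately have "AE \<omega> in M. D \<omega> = 0"
    using integral_nonneg_eq_0_iff_AE[OF int] nonneg by auto
  then have "AE \<omega> in M. \<omega> \<in> A"
    using AE_space
  proof eventually_elim
    case (elim \<omega>)
    with Z(2)[of \<omega>] show ?case
      by (cases "\<omega> \<in> A") (auto simp: D_def)
  qed
  then have "prob A = 1"
    using prob_eq_1[OF A] by simp
  moreover have "c * prob A \<le> 1"
    using \<open>expectation D \<ge> 0\<close> \<open>expectation D = expectation Z - c * prob A\<close> Z(3) by simp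
  ultimately show False
    using \<open>c > 1\<close> by simp
qed

theorem mainTheorem1:
  fixes M :: "'a measure" and X :: "nat \<Rightarrow> 'a \<Rightarrow> real" and n :: nat and x y :: real
  assumes "prob_space M"
    and "n \<ge> 1"
    and "prob_space.indep_vars M (\<lambda>_. borel) X {1..n}"
    and "identically_distributed M X {1..n}"
    and "\<And>i. i \<in> {1..n} \<Longrightarrow> symmetric_rv M (X i)"
    and "x > 0" and "y > 0"
  shows "measure M {\<omega> \<in> space M. (\<Sum>i=1..n. X i \<omega>) \<ge> x \<and> (\<Sum>i=1..n. (X i \<omega>)\<^sup>2) \<le> y}
           < exp (- (x\<^sup>2 / (2 * y)))"
proof -
  interpret prob_space M by fact
  \<comment> \<open>This \<open>t\<close> maximises \<open>t * x - t\<^sup>2 * y / 2\<close>, with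
    maximum \<open>x\<^sup>2 / (2 * y)\<close>.\<close>
  define t where "t = x / y"
  define f where "f v = exp (t * v - (t * v)\<^sup>2 / 2)" for v :: real
  define Z where "Z \<omega> = (\<Prod>i=1..n. f (X i \<omega>))" for \<omega>
  define A where
    "A = {\<omega> \<in> space M. (\<Sum>i=1..n. X i \<omega>) \<ge> x \<and> (\<Sum>i=1..n. (X i \<omega>)\<^sup>2) \<le> y}"
  have X [measurable]: "random_variable borel (X i)" if "i \<in> {1..n}" for i
    using assms(5)[OF that] by (simp add: symmetric_rv_def)
  have indep: "indep_vars (\<lambda>_. borel) (\<lambda>i \<omega>. f (X i \<omega>)) {1..n}"
    by (rule indep_vars_compose2[OF assms(3)]) (simp add: f_def)
  have int: "integrable M (\<lambda>\<omega>. f (X i \<omega>))" if "i \<in> {1..n}" for i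
    unfolding f_def by (rule integrable_self_normalised_exp[OF X[OF that]])
  \<comment> \<open>Independence turns the mean of the product into the product of the
    means.\<close>
  have "expectation Z = (\<Prod>i=1..n. expectation (\<lambda>\<omega>. f (X i \<omega>)))"
    unfolding Z_def by (rule indep_vars_lebesgue_integral[OF _ indep int]) auto
  also have "\<dots> \<le> 1"
  proof (rule prod_le_1)
    fix i assume "i \<in> {1..n}"
    then show "0 \<le> expectation (\<lambda>\<omega>. f (X i \<omega>)) \<and> expectation (\<lambda>\<omega>. f (X i \<omega>)) \<le> 1"
      using expectation_self_normalised_exp_le_1[OF assms(5)] by (simp add: f_def)
  qed
  finally have "expectation Z \<le> 1" .
  moreover have "integrable M Z"
    unfolding Z_def by (rule indep_vars_integrable[OF _ indep int]) auto
  moreover have "Z \<omega> > 0" for \<omega>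
    by (simp add: Z_def f_def prod_pos)
  moreover have "exp (x\<^sup>2 / (2 * y)) \<le> Z \<omega>" if "\<omega> \<in> A" for \<omega>
  proof -
    let ?S = "\<Sum>i=1..n. X i \<omega>" and ?V = "\<Sum>i=1..n. (X i \<omega>)\<^sup>2"
    have "x\<^sup>2 / (2 * y) = t * x - t\<^sup>2 / 2 * y"
      using \<open>y > 0\<close> by (simp add: t_def field_simps power2_eq_square)
    \<comment> \<open>On \<open>A\<close> the sum is at least \<open>x\<close> and is multiplied by
      \<open>t > 0\<close>; the sum of squares is at most \<open>y\<close> and enters with a minus
      sign.\<close>
    also have "\<dots> \<le> t * ?S - t\<^sup>2 / 2 * ?V"
      using that \<open>x > 0\<close> \<open>y > 0\<close>
      by (intro diff_mono mult_left_mono) (auto simp: A_def t_def)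
    also have "\<dots> = (\<Sum>i=1..n. t * X i \<omega> - (t * X i \<omega>)\<^sup>2 / 2)"
      by (simp add: sum_subtractf sum_distrib_left power_mult_distrib)
    finally show ?thesis
      by (simp add: Z_def f_def flip: exp_sum)
  qed
  moreover have "A \<in> events"
    unfolding A_def by measurable
  moreover have "exp (x\<^sup>2 / (2 * y)) > 1"
    using \<open>x > 0\<close> \<open>y > 0\<close> by simp
  ultimately have "prob A < 1 / exp (x\<^sup>2 / (2 * y))"
    by (intro prob_less_of_positive_weight) auto
  then show ?thesis
    by (simp add: A_def exp_minus inverse_eq_divide)
qed

end
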